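(* Let $n\ge 2$, let $\Phi:[0,1]_{\mathbb D}\to\mathbb D^{+}$ be an admissible hyperbolic generator, and let $\mathcal N_\Phi:\mathcal P_{\mathbb D}(n)\to\mathcal P_{\mathbb D}(n)$ be the hyperbolic negator generated by $\Phi$. Suppose that, for every $P=(p_1,\ldots,p_n)\in\mathcal P_{\mathbb D}(n)$, every active idempotent component $\ell\in\{1,2\}$ of $P$, and all $i,j\in\{1,\ldots,n\}$, \[ p_j^{(\ell)}=1\ \Longrightarrow\ \Phi^{(\ell)}(p_j)=0, \] and \[ p_i^{(\ell)}\le p_j^{(\ell)}<1\ \Longrightarrow\ \Phi^{(\ell)}(p_i)\ge\Phi^{(\ell)}(p_j)\ \text{ and }\ \frac{\Phi^{(\ell)}(p_i)}{1-p_i^{(\ell)}}\le\frac{\Phi^{(\ell)}(p_j)}{1-p_j^{(\ell)}}. \] Then, for every $P\in\mathcal P_{\mathbb D}(n)$, $\mathcal Y(P)\succcurlyeq_{\mathbb D,\mathrm{maj}}\mathcal N_\Phi(P)$ and $P\succcurlyeq_{\mathbb D,\mathrm{maj}}\mathcal N_\Phi(P)$, where $\mathcal Y$ is the Yager hyperbolic negator.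
   Context: Hyperbolic numbers: $\mathbb D=\{a+\mathbf k b: a,b\in\mathbb R\}$ with $\mathbf k^2=1$, $\mathbf e_1=(1+\mathbf k)/2$, $\mathbf e_2=(1-\mathbf k)/2$. Every $z\in\mathbb D$ is uniquely $z=z^{(1)}\mathbf e_1+z^{(2)}\mathbf e_2$ with $z^{(1)},z^{(2)}\in\mathbb R$; addition and multiplication are component-wise in these coordinates, and $1=\mathbf e_1+\mathbf e_2$. Partial order: $z\preceq_{\mathbb D}w$ iff $z^{(1)}\le w^{(1)}$ and $z^{(2)}\le w^{(2)}$. $\mathbb D^{+}=\{z: 0\preceq_{\mathbb D}z\}$ and $[0,1]_{\mathbb D}=\{z: 0\preceq_{\mathbb D}z\preceq_{\mathbb D}1\}$. Distributions: $\mathcal P_{\mathbb D}(n)$ is the set of $P=(p_1,\ldots,p_n)\in\mathbb D^n$ with all $p_j\in[0,1]_{\mathbb D}$ and $s(P):=\sum_j p_j\in\{1,\mathbf e_1,\mathbf e_2\}$. Write $p_j=p_j^{(1)}\mathbf e_1+p_j^{(2)}\mathbf e_2$, $P^{(\ell)}=(p_1^{(\ell)},\ldots,p_n^{(\ell)})$, $s^{(\ell)}(P)=\sum_j p_j^{(\ell)}\in\{0,1\}$. Component $\ell$ of $P$ is active if $s^{(\ell)}(P)=1$ and inactive if $s^{(\ell)}(P)=0$. Majorization: for non-negative $x,y\in\mathbb R^n$ with decreasing rearrangements $x^\downarrow,y^\downarrow$, $x$ majorizes $y$ if $\sum_{j=1}^k x_j^\downarrow\ge\sum_{j=1}^k y_j^\downarrow$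 for $k=1,\ldots,n-1$ and $\sum_{j=1}^n x_j=\sum_{j=1}^n y_j$. For $P,Q\in\mathcal P_{\mathbb D}(n)$ with $s(P)=s(Q)$, $P\succcurlyeq_{\mathbb D,\mathrm{maj}}Q$ means that $P^{(\ell)}$ majorizes $Q^{(\ell)}$ for $\ell=1,2$. Generators: a map $\Phi=\Phi^{(1)}\mathbf e_1+\Phi^{(2)}\mathbf e_2:[0,1]_{\mathbb D}\to\mathbb D^{+}$ is an admissible hyperbolic generator (for the given $n$) if (i) $z\preceq_{\mathbb D}w$ implies $\Phi(w)\preceq_{\mathbb D}\Phi(z)$, and (ii) for every $P\in\mathcal P_{\mathbb D}(n)$ and every active component $\ell$ of $P$, $Z_\ell^\Phi(P):=\sum_{j=1}^n\Phi^{(\ell)}(p_j)>0$. The generated negator is $\mathcal N_\Phi(P)=(q_1,\ldots,q_n)$ with $q_j^{(\ell)}=\Phi^{(\ell)}(p_j)/Z_\ell^\Phi(P)$ if component $\ell$ of $P$ is active, and $q_j^{(\ell)}=0$ if it is inactive. Yager hyperbolic negator: $\mathcal Y(P)=\left(\frac{s(P)-p_1}{n-1},\ldots,\frac{s(P)-p_n}{n-1}\right)$. *)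

theory Defs
  imports Complex_Main
begin

text \<open>\<open>Hyp a b\<close> is the hyperbolic number \<open>a + \<^bold>k b\<close>, where \<open>\<^bold>k\<^sup>2 = 1\<close>.\<close>

datatype hyperbolic = Hyp (hre: real) (him: real)

lemma hyperbolic_eq_iff: "z = w \<longleftrightarrow> hre z = hre w \<and> him z = him w"
  by (cases z; cases w) simp

instantiation hyperbolic :: "{comm_ring_1, real_algebra_1}"
begin

definition zero_hyperbolic :: hyperbolic where
  "0 = Hyp 0 0"

definition one_hyperbolic :: hyperbolic where
  "1 = Hyp 1 0"

definition plus_hyperbolic :: "hyperbolic \<Rightarrow> hyperbolic \<Rightarrow> hyperbolic" where
  "z + w = Hyp (hre z + hre w) (him z + him w)"

definition uminus_hyperbolic :: "hyperbolic \<Rightarrow> hyperbolic" where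
  "- z = Hyp (- hre z) (- him z)"

definition minus_hyperbolic :: "hyperbolic \<Rightarrow> hyperbolic \<Rightarrow> hyperbolic" where
  "z - w = Hyp (hre z - hre w) (him z - him w)"

definition times_hyperbolic :: "hyperbolic \<Rightarrow> hyperbolic \<Rightarrow> hyperbolic" where
  "z * w = Hyp (hre z * hre w + him z * him w) (hre z * him w + him z * hre w)"

definition scaleR_hyperbolic :: "real \<Rightarrow> hyperbolic \<Rightarrow> hyperbolic" where
  "r *\<^sub>R z = Hyp (r * hre z) (r * him z)"

instance
  by standard
    (simp_all add: hyperbolic_eq_iff zero_hyperbolic_def one_hyperbolic_def plus_hyperbolic_def
      uminus_hyperbolic_def minus_hyperbolic_def times_hyperbolic_def scaleR_hyperbolic_def
      algebra_simps)

end

definition hk :: hyperbolic where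
  "hk = Hyp 0 1"

definition he1 :: hyperbolic where
  "he1 = (1 + hk) /\<^sub>R 2"

definition he2 :: hyperbolic where
  "he2 = (1 - hk) /\<^sub>R 2"

datatype idem_index = I1 | I2

text \<open>\<open>icomp \<l> z\<close> is the idempotent coordinate \<open>z\<^sup>(\<^sup>\<l>\<^sup>)\<close>; see \<open>icomp_unique\<close>.\<close>

primrec icomp :: "idem_index \<Rightarrow> hyperbolic \<Rightarrow> real" where
  "icomp I1 z = hre z + him z"
| "icomp I2 z = hre z - him z"

lemma hk_square: "hk * hk = 1"
  by (simp add: hk_def one_hyperbolic_def times_hyperbolic_def)

lemma Hyp_eq_hk: "Hyp a b = a *\<^sub>R 1 + b *\<^sub>R hk"
  by (simp add: hk_def one_hyperbolic_def plus_hyperbolic_def scaleR_hyperbolic_def)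

lemma icomp_add [simp]: "icomp l (z + w) = icomp l z + icomp l w"
  by (cases l) (simp_all add: plus_hyperbolic_def)

lemma icomp_diff [simp]: "icomp l (z - w) = icomp l z - icomp l w"
  by (cases l) (simp_all add: minus_hyperbolic_def)

lemma icomp_mult [simp]: "icomp l (z * w) = icomp l z * icomp l w"
  by (cases l) (simp_all add: times_hyperbolic_def algebra_simps)

lemma icomp_scaleR [simp]: "icomp l (r *\<^sub>R z) = r * icomp l z"
  by (cases l) (simp_all add: scaleR_hyperbolic_def algebra_simps)

lemma icomp_zero [simp]: "icomp l 0 = 0"
  by (cases l) (simp_all add: zero_hyperbolic_def)

lemma icomp_one [simp]: "icomp l 1 = 1"
  by (cases l) (simp_all add: one_hyperbolic_def)

lemma icomp_he [simp]:
  "icomp I1 he1 = 1" "icomp I2 he1 = 0" "icomp I1 he2 = 0" "icomp I2 he2 = 1"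
  by (simp_all add: he1_def he2_def hk_def one_hyperbolic_def plus_hyperbolic_def
      minus_hyperbolic_def scaleR_hyperbolic_def)

lemma icomp_eq_iff: "z = w \<longleftrightarrow> (\<forall>l. icomp l z = icomp l w)"
proof
  assume "\<forall>l. icomp l z = icomp l w"
  from this[rule_format, of I1] this[rule_format, of I2] show "z = w"
    by (simp add: hyperbolic_eq_iff)
qed simp

lemma icomp_unique:
  "z = a *\<^sub>R he1 + b *\<^sub>R he2 \<longleftrightarrow> a = icomp I1 z \<and> b = icomp I2 z"
proof
  assume "z = a *\<^sub>R he1 + b *\<^sub>R he2"
  then show "a = icomp I1 z \<and> b = icomp I2 z"
    by (simp del: icomp.simps)
next
  assume "a = icomp I1 z \<and> b = icomp I2 z"
  then have "icomp l z = icomp l (a *\<^sub>R he1 + b *\<^sub>R he2)" for l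
    by (cases l) (simp_all del: icomp.simps)
  then show "z = a *\<^sub>R he1 + b *\<^sub>R he2"
    by (simp add: icomp_eq_iff del: icomp.simps)
qed

instantiation hyperbolic :: order
begin

definition less_eq_hyperbolic :: "hyperbolic \<Rightarrow> hyperbolic \<Rightarrow> bool" where
  "z \<le> w \<longleftrightarrow> icomp I1 z \<le> icomp I1 w \<and> icomp I2 z \<le> icomp I2 w"

definition less_hyperbolic :: "hyperbolic \<Rightarrow> hyperbolic \<Rightarrow> bool" where
  "(z::hyperbolic) < w \<longleftrightarrow> z \<le> w \<and> \<not> w \<le> z"

instance
  by standard
    (auto simp: less_eq_hyperbolic_def less_hyperbolic_def hyperbolic_eq_iff)

end

text \<open>A vector in \<open>\<D>\<^sup>n\<close> is a list of length \<open>n\<close>, so coordinates are indexed from 0.\<close>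

definition hyp_dist :: "nat \<Rightarrow> hyperbolic list set" where
  "hyp_dist n = {P. length P = n \<and> set P \<subseteq> {0..1} \<and> sum_list P \<in> {1, he1, he2}}"

definition active :: "idem_index \<Rightarrow> hyperbolic list \<Rightarrow> bool" where
  "active l P \<longleftrightarrow> sum_list (map (icomp l) P) = 1"

definition majorizes :: "real list \<Rightarrow> real list \<Rightarrow> bool" where
  "majorizes x y \<longleftrightarrow> length x = length y \<and>
     (\<forall>k\<in>{1..<length x}. sum_list (take k (rev (sort x))) \<ge> sum_list (take k (rev (sort y)))) \<and>
     sum_list x = sum_list y"

text \<open>The relation is only meaningful between distributions in \<open>hyp_dist n\<close> with the same total;
  these requirements are part of the definition.\<close>

definition hyp_majorizes :: "nat \<Rightarrow> hyperbolic list \<Rightarrow> hyperbolic list \<Rightarrow> bool" where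
  "hyp_majorizes n P Q \<longleftrightarrow> P \<in> hyp_dist n \<and> Q \<in> hyp_dist n \<and> sum_list P = sum_list Q \<and>
     (\<forall>l. majorizes (map (icomp l) P) (map (icomp l) Q))"

definition gen_sum :: "(hyperbolic \<Rightarrow> hyperbolic) \<Rightarrow> idem_index \<Rightarrow> hyperbolic list \<Rightarrow> real" where
  "gen_sum \<Phi> l P = (\<Sum>p\<leftarrow>P. icomp l (\<Phi> p))"

text \<open>A generator is a total function of which only the values on \<open>{0..1}\<close> matter.\<close>

definition admissible_generator :: "nat \<Rightarrow> (hyperbolic \<Rightarrow> hyperbolic) \<Rightarrow> bool" where
  "admissible_generator n \<Phi> \<longleftrightarrow>
     (\<forall>z\<in>{0..1}. 0 \<le> \<Phi> z) \<and>
     (\<forall>z\<in>{0..1}. \<forall>w\<in>{0..1}. z \<le> w \<longrightarrow> \<Phi> w \<le> \<Phi> z) \<and>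
     (\<forall>P\<in>hyp_dist n. \<forall>l. active l P \<longrightarrow> gen_sum \<Phi> l P > 0)"

definition negator_comp ::
  "(hyperbolic \<Rightarrow> hyperbolic) \<Rightarrow> hyperbolic list \<Rightarrow> idem_index \<Rightarrow> hyperbolic \<Rightarrow> real" where
  "negator_comp \<Phi> P l p = (if active l P then icomp l (\<Phi> p) / gen_sum \<Phi> l P else 0)"

definition negator :: "(hyperbolic \<Rightarrow> hyperbolic) \<Rightarrow> hyperbolic list \<Rightarrow> hyperbolic list" where
  "negator \<Phi> P = map (\<lambda>p. negator_comp \<Phi> P I1 p *\<^sub>R he1 + negator_comp \<Phi> P I2 p *\<^sub>R he2) P"

definition yager :: "nat \<Rightarrow> hyperbolic list \<Rightarrow> hyperbolic list" where
  "yager n P = map (\<lambda>p. (sum_list P - p) /\<^sub>R (real n - 1)) P"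

end

theory Submission
  imports Defs "HOL-Library.Multiset"
begin

text \<open>In an active component, both \<open>\<Y>(P)\<close> and \<open>\<N>\<^sub>\<Phi>(P)\<close> are decreasing functions of
  \<open>p\<^sub>j\<close>, so the \<open>k\<close> indices with the smallest \<open>p\<^sub>j\<close> carry the \<open>k\<close> largest entries of both.
  As the quotient of \<open>\<N>\<^sub>\<Phi>(P)\<close> by \<open>\<Y>(P)\<close> increases with \<open>p\<^sub>j\<close>, summing
  \<open>q\<^sub>i y\<^sub>j \<le> q\<^sub>j y\<^sub>i\<close> over these \<open>i\<close> and the remaining \<open>j\<close> compares the partial sums.
  Moreover \<open>P\<close> majorizes \<open>\<Y>(P)\<close>, since each entry of the latter is the mean of the other
  \<open>n - 1\<close> entries of \<open>P\<close>; transitivity gives the second claim.\<close>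

section \<open>Partial sums of decreasing rearrangements as extremal sums\<close>

lemma weighted_sum_le_sum_top_set:
  fixes x w :: "nat \<Rightarrow> real"
  assumes "J \<subseteq> A" "finite A"
    and top: "\<And>i j. i \<in> J \<Longrightarrow> j \<in> A - J \<Longrightarrow> x j \<le> x i"
    and w: "\<And>i. i \<in> A \<Longrightarrow> 0 \<le> w i \<and> w i \<le> 1"
    and sum_w: "sum w A = real (card J)"
  shows "(\<Sum>i\<in>A. w i * x i) \<le> sum x J"
proof (cases "J = {}")
  case True
  then have "w i = 0" if "i \<in> A" for i
    using sum_w w \<open>finite A\<close> that by (simp add: sum_nonneg_eq_0_iff)
  then show ?thesis using True by simp
next
  case False
  have "finite J" using assms finite_subset by blast
  \<comment> \<open>The threshold \<open>t\<close> separates the values on \<open>J\<close> from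
    those outside. After shifting \<open>x\<close> by \<open>t\<close>, weights in the unit interval
    can only shrink the terms on \<open>J\<close> and make those outside nonpositive. Both sides
    have total weight \<open>card J\<close>, so the shift cancels.\<close>
  define t where "t = Min (x ` J)"
  have t_le: "t \<le> x i" if "i \<in> J" for i
    using that \<open>finite J\<close> by (simp add: t_def)
  have "t \<in> x ` J"
    unfolding t_def using \<open>finite J\<close> False by (intro Min_in) auto
  then have le_t: "x j \<le> t" if "j \<in> A - J" for j
    using top that by auto
  have split: "sum f A = sum f J + sum f (A - J)" for f :: "nat \<Rightarrow> real"
    using assms sum.subset_diff by (metis add.commute)
  have "(\<Sum>i\<in>A. w i * (x i - t)) = (\<Sum>i\<in>J. w i * (x i - t)) + (\<Sum>i\<in>A-J. w i * (x i - t))"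
    by (rule split)
  also have "\<dots> \<le> (\<Sum>i\<in>J. x i - t) + 0"
  proof (rule add_mono)
    show "(\<Sum>i\<in>J. w i * (x i - t)) \<le> (\<Sum>i\<in>J. x i - t)"
      using w t_le \<open>J \<subseteq> A\<close> by (intro sum_mono mult_left_le_one_le) auto
    show "(\<Sum>i\<in>A-J. w i * (x i - t)) \<le> 0"
      using w le_t by (intro sum_nonpos mult_nonneg_nonpos) auto
  qed
  finally have "(\<Sum>i\<in>A. w i * (x i - t)) \<le> (\<Sum>i\<in>J. x i - t)" by simp
  moreover have "(\<Sum>i\<in>A. w i * (x i - t)) = (\<Sum>i\<in>A. w i * x i) - real (card J) * t"
    by (simp add: algebra_simps sum_subtractf sum_w flip: sum_distrib_left)
  ultimately show ?thesis
    by (simp add: sum_subtractf)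
qed

text \<open>Indices are sorted instead of values: the first \<open>k\<close> of them form a set of
  exactly \<open>k\<close> positions even when entries of \<open>x\<close> coincide.\<close>

lemma ex_top_set:
  fixes x :: "real list"
  assumes "k \<le> length x"
  obtains J where "J \<subseteq> {..<length x}" "card J = k"
    "sum_list (take k (rev (sort x))) = (\<Sum>i\<in>J. x ! i)"
    "\<And>i j. i \<in> J \<Longrightarrow> j \<in> {..<length x} - J \<Longrightarrow> x ! j \<le> x ! i"
proof -
  define ns where "ns = rev (sort_key ((!) x) [0..<length x])"
  have ns: "distinct ns" "set ns = {..<length x}" "length ns = length x"
    by (auto simp: ns_def)
  have "sort x = map ((!) x) (sort_key ((!) x) [0..<length x])"
    by (rule properties_for_sort) (metis map_nth mset_map mset_sort, simp)
  then have sort_x: "rev (sort x) = map ((!) x) ns"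
    by (simp add: ns_def rev_map)
  have "sorted_wrt (\<ge>) (map ((!) x) ns)"
    unfolding sort_x[symmetric] by (simp add: sorted_wrt_rev)
  then have sorted: "x ! (ns ! b) \<le> x ! (ns ! a)" if "a < b" "b < length x" for a b
    using that ns by (auto simp: sorted_wrt_iff_nth_less)
  show ?thesis
  proof
    show "set (take k ns) \<subseteq> {..<length x}"
      using ns set_take_subset by metis
    show "card (set (take k ns)) = k"
      using ns assms by (simp add: distinct_card)
    show "sum_list (take k (rev (sort x))) = (\<Sum>i\<in>set (take k ns). x ! i)"
      using ns by (simp add: sort_x take_map sum_list_distinct_conv_sum_set)
    fix i j
    assume i: "i \<in> set (take k ns)" and j: "j \<in> {..<length x} - set (take k ns)"
    obtain a where a: "a < k" "a < length ns" "i = ns ! a"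
      using i by (auto simp: in_set_conv_nth)
    obtain b where b: "b < length ns" "j = ns ! b"
      using j ns by (metis DiffD1 in_set_conv_nth)
    have "\<not> b < k"
      using b j by (auto simp: in_set_conv_nth)
    then show "x ! j \<le> x ! i"
      using a b sorted[of a b] ns by simp
  qed
qed

lemma weighted_sum_le_top_sum:
  fixes x :: "real list"
  assumes "k \<le> length x"
    and w: "\<And>i. i < length x \<Longrightarrow> 0 \<le> w i \<and> w i \<le> 1"
    and sum_w: "sum w {..<length x} = real k"
  shows "(\<Sum>i<length x. w i * x ! i) \<le> sum_list (take k (rev (sort x)))"
proof -
  obtain J where J: "J \<subseteq> {..<length x}" "card J = k"
    "sum_list (take k (rev (sort x))) = (\<Sum>i\<in>J. x ! i)"
    "\<And>i j. i \<in> J \<Longrightarrow> j \<in> {..<length x} - J \<Longrightarrow> x ! j \<le> x ! i"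
    using ex_top_set assms(1) by metis
  show ?thesis
    unfolding J(3) using assms J by (intro weighted_sum_le_sum_top_set) auto
qed

text \<open>This lets a set chosen by the order of another list evaluate the partial sum of
  \<open>x\<close>. The set \<open>I\<close> from \<open>ex_top_set\<close> has the same size as
  \<open>J\<close>, so its indicator serves as the weight.\<close>

lemma top_sum_le_sum_top_set:
  fixes x :: "real list"
  assumes J: "J \<subseteq> {..<length x}"
    and top: "\<And>i j. i \<in> J \<Longrightarrow> j \<in> {..<length x} - J \<Longrightarrow> x ! j \<le> x ! i"
  shows "sum_list (take (card J) (rev (sort x))) \<le> (\<Sum>i\<in>J. x ! i)"
proof -
  have "card J \<le> length x"
    using J card_mono[of "{..<length x}" J] by simp
  then obtain I where I: "I \<subseteq> {..<length x}" "card I = card J"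
    "sum_list (take (card J) (rev (sort x))) = (\<Sum>i\<in>I. x ! i)"
    using ex_top_set by metis
  have Int: "{..<length x} \<inter> I = I" using I by auto
  have "(\<Sum>i<length x. of_bool (i \<in> I) * x ! i) \<le> (\<Sum>i\<in>J. x ! i)"
    using J top I Int by (intro weighted_sum_le_sum_top_set) (auto simp: sum.If_cases of_bool_def)
  moreover have "(\<Sum>i<length x. of_bool (i \<in> I) * x ! i) = (\<Sum>i\<in>I. x ! i)"
    using Int by (simp add: of_bool_def if_distrib[of "\<lambda>t. t * _"] sum.If_cases cong: if_cong)
  ultimately show ?thesis using I by simp
qed

section \<open>Majorization between real lists\<close>

lemma majorizes_refl: "majorizes x x"
  by (simp add: majorizes_def)

lemma majorizes_trans: "majorizes x y \<Longrightarrow> majorizes y z \<Longrightarrow> majorizes x z"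
  unfolding majorizes_def by force

text \<open>Monotonicity of the quotient is stated in cross-multiplied form, because an entry of
  \<open>y\<close> may be zero.\<close>

lemma majorizes_of_ratio_mono:
  fixes y q :: "real list"
  assumes len: "length y = length q"
    and sums: "sum_list y = 1" "sum_list q = 1"
    and mono: "\<And>i j. i < length q \<Longrightarrow> j < length q \<Longrightarrow> y ! j \<le> y ! i \<Longrightarrow>
      q ! j \<le> q ! i \<and> q ! i * y ! j \<le> q ! j * y ! i"
  shows "majorizes y q"
  unfolding majorizes_def
proof (intro conjI ballI)
  fix k assume k: "k \<in> {1..<length y}"
  let ?A = "{..<length q}"
  obtain J where J: "J \<subseteq> ?A" "card J = k"
    "sum_list (take k (rev (sort y))) = (\<Sum>i\<in>J. y ! i)"
    "\<And>i j. i \<in> J \<Longrightarrow> j \<in> ?A - J \<Longrightarrow> y ! j \<le> y ! i"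
    using ex_top_set[of k y] k len by (metis atLeastLessThan_iff less_imp_le)
  have compl: "(\<Sum>i\<in>?A - J. z ! i) = 1 - (\<Sum>i\<in>J. z ! i)"
    if "length z = length q" "sum_list z = 1" for z :: "real list"
    using that J(1) by (simp add: sum_diff sum_list_sum_nth atLeast0LessThan)
  have "(\<Sum>i\<in>J. \<Sum>j\<in>?A - J. q ! i * y ! j) \<le> (\<Sum>i\<in>J. \<Sum>j\<in>?A - J. q ! j * y ! i)"
    using J mono by (intro sum_mono) auto
  then have "(\<Sum>i\<in>J. q ! i) * (\<Sum>j\<in>?A - J. y ! j) \<le> (\<Sum>j\<in>?A - J. q ! j) * (\<Sum>i\<in>J. y ! i)"
    by (simp add: sum_product sum.swap[of _ "?A - J"])
  \<comment> \<open>Both totals are 1, so with \<open>a\<close> and \<open>b\<close> the sums of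
    \<open>q\<close> and \<open>y\<close> over \<open>J\<close> the inequality reads
    \<open>a * (1 - b) \<le> (1 - a) * b\<close>; the products cancel.\<close>
  then have "(\<Sum>i\<in>J. q ! i) \<le> (\<Sum>i\<in>J. y ! i)"
    using sums len by (simp add: compl algebra_simps)
  moreover have "sum_list (take k (rev (sort q))) \<le> (\<Sum>i\<in>J. q ! i)"
    unfolding J(2)[symmetric]
  proof (rule top_sum_le_sum_top_set)
    fix i j assume "i \<in> J" "j \<in> ?A - J"
    then show "q ! j \<le> q ! i"
      using J(1) J(4)[of i j] mono[of i j] by auto
  qed (rule J(1))
  ultimately show "sum_list (take k (rev (sort q))) \<le> sum_list (take k (rev (sort y)))"
    using J by simp
qed (use assms in auto)

lemma sum_list_complement:
  fixes p :: "real list"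
  shows "(\<Sum>t\<leftarrow>p. (a - t) / c) = (real (length p) * a - sum_list p) / c"
  by (induction p) (auto simp: algebra_simps add_divide_distrib diff_divide_distrib)

text \<open>A sum of \<open>k\<close> of the means is a weighted sum of all entries of
  \<open>p\<close>, with weights \<open>(k - 1) / (n - 1)\<close> on the chosen indices and
  \<open>k / (n - 1)\<close> elsewhere, where \<open>n\<close> is the length. For
  \<open>1 \<le> k < n\<close> these lie in the unit interval, and they add up to
  \<open>k\<close>.\<close>

lemma majorizes_yager_real:
  fixes p :: "real list"
  assumes len: "length p \<ge> 2" and sum_p: "sum_list p = 1"
  shows "majorizes p (map (\<lambda>t. (1 - t) / (real (length p) - 1)) p)" (is "majorizes p ?y")
  unfolding majorizes_def
proof (intro conjI ballI)
  let ?n = "length p"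
  fix k assume k: "k \<in> {1..<?n}"
  obtain J where J: "J \<subseteq> {..<?n}" "card J = k"
    "sum_list (take k (rev (sort ?y))) = (\<Sum>i\<in>J. ?y ! i)"
    using ex_top_set[of k ?y] k by auto
  have Int: "{..<?n} \<inter> J = J" using J by auto
  \<comment> \<open>The coefficient of \<open>p\<^sub>i\<close> when each chosen entry is expanded as a mean of the others.\<close>
  define w where "w i = (real k - of_bool (i \<in> J)) / (real ?n - 1)" for i
  have restrict: "(\<Sum>i<?n. of_bool (i \<in> J) * f i) = sum f J" for f :: "nat \<Rightarrow> real"
    using Int by (simp add: of_bool_def if_distrib[of "\<lambda>t. t * _"] sum.If_cases cong: if_cong)
  have "(\<Sum>i\<in>J. ?y ! i) = (\<Sum>i\<in>J. (1 - p ! i) / (real ?n - 1))"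
    using J by (intro sum.cong) auto
  also have "\<dots> = (real k - (\<Sum>i\<in>J. p ! i)) / (real ?n - 1)"
    using J by (simp add: sum_subtractf flip: sum_divide_distrib)
  also have "\<dots> = (\<Sum>i<?n. w i * p ! i)"
    using restrict[of "(!) p"] sum_p
    by (simp add: w_def left_diff_distrib sum_subtractf sum_list_sum_nth atLeast0LessThan
        flip: sum_divide_distrib sum_distrib_left)
  also have "\<dots> \<le> sum_list (take k (rev (sort p)))"
  proof (rule weighted_sum_le_top_sum)
    show "sum w {..<?n} = real k"
      using restrict[of "\<lambda>_. 1"] J len
      by (simp add: w_def sum_subtractf field_simps flip: sum_divide_distrib)
    show "0 \<le> w i \<and> w i \<le> 1" for i
      using k by (auto simp: w_def divide_simps)
  qed (use k in auto)
  finally show "sum_list (take k (rev (sort ?y))) \<le> sum_list (take k (rev (sort p)))"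
    using J by simp
qed (use assms in \<open>auto simp: sum_list_complement\<close>)

section \<open>Idempotent components of distributions and negators\<close>

lemma icomp_sum_list: "icomp l (sum_list P) = sum_list (map (icomp l) P)"
  by (induction P) (simp_all del: icomp.simps)

lemma less_eq_hyperbolic_iff: "z \<le> w \<longleftrightarrow> (\<forall>l. icomp l z \<le> icomp l w)"
  unfolding less_eq_hyperbolic_def by (metis idem_index.exhaust)

lemma icomp_idempotent_sum [simp]: "icomp l (a *\<^sub>R he1 + b *\<^sub>R he2) = (case l of I1 \<Rightarrow> a | I2 \<Rightarrow> b)"
  by (cases l) (simp_all del: icomp.simps)

lemma hyp_dist_icomp:
  assumes "P \<in> hyp_dist n"
  shows "length P = n" "p \<in> set P \<Longrightarrow> 0 \<le> icomp l p" "p \<in> set P \<Longrightarrow> icomp l p \<le> 1"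
    and "sum_list (map (icomp l) P) = (if active l P then 1 else 0)"
proof -
  have "icomp l (sum_list P) = 0 \<or> icomp l (sum_list P) = 1"
    using assms unfolding hyp_dist_def by (cases l) (auto simp del: icomp.simps)
  then show "sum_list (map (icomp l) P) = (if active l P then 1 else 0)"
    by (auto simp: active_def icomp_sum_list simp del: icomp.simps)
qed (use assms in \<open>force simp: hyp_dist_def less_eq_hyperbolic_iff simp del: icomp.simps\<close>)+

text \<open>Nonnegative entries are bounded by their sum, which is 0 or 1 in each component, so the
  upper bound 1 comes for free. Both negators are shown to be distributions this way.\<close>

lemma hyp_distI:
  assumes P: "P \<in> hyp_dist n" and "length Q = n"
    and nonneg: "\<And>l q. q \<in> set Q \<Longrightarrow> 0 \<le> icomp l q"
    and sums: "\<And>l. sum_list (map (icomp l) Q) = sum_list (map (icomp l) P)"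
  shows "Q \<in> hyp_dist n" "sum_list P = sum_list Q"
proof -
  show eq: "sum_list P = sum_list Q"
    by (simp add: icomp_eq_iff icomp_sum_list sums del: icomp.simps)
  have "icomp l q \<le> 1" if "q \<in> set Q" for l q
  proof -
    have "icomp l q \<le> sum_list (map (icomp l) Q)"
      using that nonneg by (intro member_le_sum_list) auto
    also have "\<dots> \<le> 1"
      unfolding sums hyp_dist_icomp(4)[OF P] by simp
    finally show ?thesis .
  qed
  then show "Q \<in> hyp_dist n"
    using P eq assms(2) nonneg
    by (auto simp: hyp_dist_def less_eq_hyperbolic_iff simp del: icomp.simps)
qed

lemma inactive_icomp_eq_0:
  assumes "P \<in> hyp_dist n" "\<not> active l P" "p \<in> set P"
  shows "icomp l p = 0"
proof -
  have "sum_list (map (icomp l) P) = 0" "\<forall>x\<in>set (map (icomp l) P). 0 \<le> x"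
    using hyp_dist_icomp[OF assms(1)] assms(2) by auto
  then show ?thesis
    using assms(3) by (metis (no_types, lifting) imageI list.set_map sum_list_nonneg_eq_0_iff)
qed

text \<open>In an inactive component all entries of \<open>P\<close> and of its image vanish.
  Writing the image as \<open>map (icomp l) P\<close> there, as for \<open>negator\<close> below,
  reduces that case to reflexivity of majorization.\<close>

lemma map_icomp_yager:
  assumes "P \<in> hyp_dist n"
  shows "map (icomp l) (yager n P) =
    (if active l P then map (\<lambda>t. (1 - t) / (real n - 1)) (map (icomp l) P) else map (icomp l) P)"
  using hyp_dist_icomp(4)[OF assms] inactive_icomp_eq_0[OF assms]
  by (auto simp: yager_def icomp_sum_list divide_inverse mult.commute simp del: icomp.simps)

lemma map_icomp_negator:
  assumes "P \<in> hyp_dist n"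
  shows "map (icomp l) (negator \<Phi> P) =
    (if active l P then map (\<lambda>p. icomp l (\<Phi> p) / gen_sum \<Phi> l P) P else map (icomp l) P)"
  using inactive_icomp_eq_0[OF assms]
  by (cases l) (auto simp: negator_def negator_comp_def simp del: icomp.simps)

theorem theorem5p2:
  fixes n :: nat and \<Phi> :: "hyperbolic \<Rightarrow> hyperbolic"
  assumes "n \<ge> 2"
    and "admissible_generator n \<Phi>"
    and "\<And>P l j. P \<in> hyp_dist n \<Longrightarrow> active l P \<Longrightarrow> j < n \<Longrightarrow>
           icomp l (P ! j) = 1 \<Longrightarrow> icomp l (\<Phi> (P ! j)) = 0"
    and "\<And>P l i j. P \<in> hyp_dist n \<Longrightarrow> active l P \<Longrightarrow> i < n \<Longrightarrow> j < n \<Longrightarrow>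
           icomp l (P ! i) \<le> icomp l (P ! j) \<Longrightarrow> icomp l (P ! j) < 1 \<Longrightarrow>
           icomp l (\<Phi> (P ! i)) \<ge> icomp l (\<Phi> (P ! j)) \<and>
           icomp l (\<Phi> (P ! i)) / (1 - icomp l (P ! i))
             \<le> icomp l (\<Phi> (P ! j)) / (1 - icomp l (P ! j))"
  shows "\<forall>P \<in> hyp_dist n.
           hyp_majorizes n (yager n P) (negator \<Phi> P) \<and> hyp_majorizes n P (negator \<Phi> P)"
proof
  fix P assume P: "P \<in> hyp_dist n"
  note len = hyp_dist_icomp(1)[OF P]
  have \<Phi>_nonneg: "0 \<le> icomp l (\<Phi> p)" if "p \<in> set P" for l p
    using assms(2) P that unfolding admissible_generator_def hyp_dist_def
    by (force simp: less_eq_hyperbolic_iff simp del: icomp.simps)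
  have gen_pos: "0 < gen_sum \<Phi> l P" if "active l P" for l
    using assms(2) P that by (auto simp: admissible_generator_def)
  have sum_yager: "sum_list (map (icomp l) (yager n P)) = sum_list (map (icomp l) P)" for l
    using assms(1) len hyp_dist_icomp(4)[OF P, of l]
      sum_list_complement[of 1 "real n - 1" "map (icomp l) P"]
    by (simp add: map_icomp_yager[OF P] del: icomp.simps)
  have sum_negator: "sum_list (map (icomp l) (negator \<Phi> P)) = sum_list (map (icomp l) P)" for l
    using gen_pos[of l] hyp_dist_icomp(4)[OF P, of l]
    by (auto simp: map_icomp_negator[OF P] gen_sum_def divide_inverse sum_list_mult_const
        simp del: icomp.simps)
  have yager_nonneg: "0 \<le> icomp l q" if "q \<in> set (yager n P)" for l q
  proof -
    have "icomp l q \<in> set (map (icomp l) (yager n P))" using that by simp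
    then show ?thesis
      using assms(1) hyp_dist_icomp(2,3)[OF P]
      by (auto simp: map_icomp_yager[OF P] simp del: icomp.simps list.set_map split: if_splits)
  qed
  have negator_nonneg: "0 \<le> icomp l q" if "q \<in> set (negator \<Phi> P)" for l q
  proof -
    have "icomp l q \<in> set (map (icomp l) (negator \<Phi> P))" using that by simp
    then show ?thesis
      using \<Phi>_nonneg gen_pos[of l] hyp_dist_icomp(2)[OF P]
      by (auto simp: map_icomp_negator[OF P] simp del: icomp.simps list.set_map split: if_splits)
  qed
  have yager: "yager n P \<in> hyp_dist n" "sum_list P = sum_list (yager n P)"
    by (rule hyp_distI[OF P _ yager_nonneg sum_yager]; simp add: yager_def len)+
  have negator: "negator \<Phi> P \<in> hyp_dist n" "sum_list P = sum_list (negator \<Phi> P)"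
    by (rule hyp_distI[OF P _ negator_nonneg sum_negator]; simp add: negator_def len)+
  have maj_yager: "majorizes (map (icomp l) P) (map (icomp l) (yager n P))" for l
    using majorizes_yager_real[of "map (icomp l) P"] assms(1) len hyp_dist_icomp(4)[OF P, of l]
    by (simp add: map_icomp_yager[OF P] majorizes_refl del: icomp.simps)
  have maj_negator:
    "majorizes (map (icomp l) (yager n P)) (map (icomp l) (negator \<Phi> P))" for l
  proof (cases "active l P")
    case False
    then show ?thesis
      by (simp add: map_icomp_yager[OF P] map_icomp_negator[OF P] majorizes_refl)
  next
    case act: True
    have cross: "icomp l (\<Phi> (P ! j)) \<le> icomp l (\<Phi> (P ! i)) \<and>
        icomp l (\<Phi> (P ! i)) * (1 - icomp l (P ! j)) \<le> icomp l (\<Phi> (P ! j)) * (1 - icomp l (P ! i))"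
      if ij: "i < n" "j < n" and le: "icomp l (P ! i) \<le> icomp l (P ! j)" for i j
    proof (cases "icomp l (P ! j) = 1")
      case True
      then show ?thesis
        using assms(3)[OF P act ij(2)] \<Phi>_nonneg ij len by (simp del: icomp.simps)
    next
      case False
      then have "icomp l (P ! j) < 1"
        using hyp_dist_icomp(3)[OF P, of "P ! j" l] ij len by (simp del: icomp.simps)
      then show ?thesis
        using assms(4)[OF P act ij le] le by (simp add: field_simps del: icomp.simps)
    qed
    show ?thesis
    proof (rule majorizes_of_ratio_mono)
      show "length (map (icomp l) (yager n P)) = length (map (icomp l) (negator \<Phi> P))"
        by (simp add: yager_def negator_def)
      show "sum_list (map (icomp l) (yager n P)) = 1" "sum_list (map (icomp l) (negator \<Phi> P)) = 1"
        using act by (simp_all add: sum_yager sum_negator active_def)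
      fix i j
      let ?y = "map (icomp l) (yager n P)" and ?q = "map (icomp l) (negator \<Phi> P)"
      assume "i < length ?q" "j < length ?q" and le: "?y ! j \<le> ?y ! i"
      then have ij: "i < n" "j < n" by (simp_all add: negator_def len)
      have y: "?y ! m = (1 - icomp l (P ! m)) / (real n - 1)" if "m < n" for m
        unfolding map_icomp_yager[OF P] using that act len by (simp del: icomp.simps)
      have q: "?q ! m = icomp l (\<Phi> (P ! m)) / gen_sum \<Phi> l P" if "m < n" for m
        unfolding map_icomp_negator[OF P] using that act len by (simp del: icomp.simps)
      \<comment> \<open>The Yager map reverses the order, and \<open>n - 1\<close> is
        positive.\<close>
      have "icomp l (P ! i) \<le> icomp l (P ! j)"
        using le assms(1) unfolding y[OF ij(1)] y[OF ij(2)]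
        by (simp add: divide_le_cancel del: icomp.simps)
      \<comment> \<open>The normalizations \<open>gen_sum \<Phi> l P\<close> and
        \<open>n - 1\<close> are positive and common to both sides.\<close>
      from cross[OF ij this] show "?q ! j \<le> ?q ! i \<and> ?q ! i * ?y ! j \<le> ?q ! j * ?y ! i"
        unfolding y[OF ij(1)] y[OF ij(2)] q[OF ij(1)] q[OF ij(2)]
        using gen_pos[OF act] assms(1)
        by (simp add: divide_right_mono del: icomp.simps)
    qed
  qed
  show "hyp_majorizes n (yager n P) (negator \<Phi> P) \<and> hyp_majorizes n P (negator \<Phi> P)"
    unfolding hyp_majorizes_def
    using P yager negator maj_negator majorizes_trans[OF maj_yager maj_negator] by simp
qed

end
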